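(* Let $q=p^{e}$ with $p$ an odd prime and $e\ge 1$, and let $l$ be an integer with $0\leq l\leq e-1$ and $2l\mid e$. Let $m$ be a positive integer with $m\mid (q-1)$. Set $y:=\frac{q-1}{p^{l}-1}$ and $m_{1}=\frac{m}{\gcd(m,y)}$. Let $n=rm$, where $r$ is an integer with $1\leq r\leq \frac{p^{l}-1}{m_{1}}$. Then for any integer $k$ with $1\leq k\leq \left\lfloor\frac{p^{l}+n}{p^{l}+1}\right\rfloor$: (1) there exists an $[n,k]_{q}$ MDS code $\mathcal{C}$ with $h$-dimensional $l$-Galois hull, for any integer $0\leq h\leq k-1$; (2) there exists an $[n+1,k]_{q}$ MDS code $\mathcal{C}$ with $h$-dimensional $l$-Galois hull, for any integer $0\leq h\leq k$; (3) there exists an $[n+2,k]_{q}$ MDS code $\mathcal{C}$ with $h$-dimensional $l$-Galois hull, for any integer $0\leq h\leq k-1$.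
   Context: An $[N,k]_q$ code is a $k$-dimensional linear subspace $\mathcal{C}$ of $\mathbb{F}_q^N$; it is MDS if its minimum Hamming distance equals $N-k+1$. For $\mathbf{x},\mathbf{y}\in\mathbb{F}_q^N$ with $q=p^e$, the $l$-Galois form is $(\mathbf{x},\mathbf{y})_l=\sum_{i=1}^N x_i y_i^{p^l}$. The $l$-Galois dual of $\mathcal{C}$ is $\mathcal{C}^{\perp_l}=\{\mathbf{x}\in\mathbb{F}_q^N : (\mathbf{y},\mathbf{x})_l=0 \text{ for all } \mathbf{y}\in\mathcal{C}\}$, and the $l$-Galois hull is $Hull_l(\mathcal{C})=\mathcal{C}\cap\mathcal{C}^{\perp_l}$; "with $h$-dimensional $l$-Galois hull" means $\dim_{\mathbb{F}_q}Hull_l(\mathcal{C})=h$. *)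

theory Defs
  imports "Jordan_Normal_Form.VS_Connect" "HOL-Computational_Algebra.Primes" "HOL-Library.Cardinality"
begin

definition code_dim :: "nat \<Rightarrow> 'a::field vec set \<Rightarrow> nat" where
  "code_dim N C = vectorspace.dim class_ring ((module_vec TYPE('a) N)\<lparr>carrier := C\<rparr>)"

definition linear_code :: "nat \<Rightarrow> nat \<Rightarrow> 'a::field vec set \<Rightarrow> bool" where
  "linear_code N k C \<longleftrightarrow>
     VectorSpace.subspace class_ring C (module_vec TYPE('a) N) \<and> code_dim N C = k"

definition hamming_dist :: "'a vec \<Rightarrow> 'a vec \<Rightarrow> nat" where
  "hamming_dist x y = card {i. i < dim_vec x \<and> x $ i \<noteq> y $ i}"

text \<open>Only meaningful for codes with at least two words, since the infimum of the empty
  set of natural numbers is unspecified; this holds for every linear code of dimension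
  at least 1.\<close>
definition min_dist :: "'a vec set \<Rightarrow> nat" where
  "min_dist C = Inf {hamming_dist x y | x y. x \<in> C \<and> y \<in> C \<and> x \<noteq> y}"

text \<open>The subtraction does not truncate: a linear code of length \<open>N\<close> has dimension at most \<open>N\<close>.\<close>
definition mds_code :: "nat \<Rightarrow> nat \<Rightarrow> 'a::field vec set \<Rightarrow> bool" where
  "mds_code N k C \<longleftrightarrow> linear_code N k C \<and> min_dist C = N - k + 1"

text \<open>In the following, \<open>p\<close> is meant to be the characteristic of the field.\<close>

definition galois_form :: "nat \<Rightarrow> nat \<Rightarrow> 'a::field vec \<Rightarrow> 'a vec \<Rightarrow> 'a" where
  "galois_form p l x y = (\<Sum>i<dim_vec x. x $ i * (y $ i) ^ (p ^ l))"

definition galois_dual :: "nat \<Rightarrow> nat \<Rightarrow> nat \<Rightarrow> 'a::field vec set \<Rightarrow> 'a vec set" where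
  "galois_dual p l N C = {x \<in> carrier_vec N. \<forall>y\<in>C. galois_form p l y x = 0}"

definition galois_hull :: "nat \<Rightarrow> nat \<Rightarrow> nat \<Rightarrow> 'a::field vec set \<Rightarrow> 'a vec set" where
  "galois_hull p l N C = C \<inter> galois_dual p l N C"

end

theory Submission
  imports Defs
begin

text \<open>
  Write \<open>K = p ^ l\<close> and \<open>t = (K - 1) / m\<^sub>1\<close>, so that \<open>m * t\<close> divides \<open>q - 1\<close>. Choose \<open>r\<close> of the \<open>t\<close>
  roots \<open>b\<close> of \<open>b ^ t = 1\<close> and let \<open>A\<close> be the set of their \<open>m\<close>-th roots, a set of \<open>n\<close> points that
  does not contain 0. On \<open>A\<close> the map \<open>x \<mapsto> x ^ K\<close> multiplies each point by an \<open>m\<close>-th root of unity.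
  This makes the products \<open>\<Prod>y. x - y\<close> over the other points \<open>y\<close> of \<open>A \<union> {0}\<close> fixed by the
  Frobenius power, hence norms \<open>u ^ (K + 1)\<close>, because \<open>K\<^sup>2 - 1\<close> divides \<open>q - 1\<close>. With the
  column multipliers \<open>1 / u\<close>, Lagrange's identity for polynomials \<open>P * Q ^ K\<close> of degree less
  than \<open>n\<close> makes the generalized Reed-Solomon code on \<open>A \<union> {0}\<close> self-orthogonal.

  Deleting the point 0 or adding the point at infinity turns the Galois form into a rank one
  form in the corresponding coordinate. Scaling \<open>s\<close> coordinates by some \<open>\<alpha>\<close> with
  \<open>\<alpha> ^ (K + 1) \<noteq> 1\<close> adds a diagonal form in these coordinates. As long as at most \<open>k\<close> coordinates
  are involved, they are independent, and the hull consists of the codewords vanishing there.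
\<close>

section \<open>Finite fields\<close>

lemma finite_field_power_card:
  fixes x :: "'a::{field,finite}"
  assumes "x \<noteq> 0"
  shows "x ^ (CARD('a) - 1) = 1"
proof -
  have "(\<Prod>y\<in>UNIV-{0}. x * y) = (\<Prod>y\<in>UNIV-{0}. y)"
    by (rule prod.reindex_bij_witness[of _ "\<lambda>y. y / x" "\<lambda>y. x * y"]) (use assms in auto)
  then have "x ^ (CARD('a) - 1) * \<Prod>(UNIV - {0}) = \<Prod>(UNIV - {0})"
    by (simp add: prod.distrib)
  moreover have "\<Prod>(UNIV - {0 :: 'a}) \<noteq> 0"
    by simp
  ultimately show ?thesis
    by simp
qed

lemma CHAR_eqI_card:
  assumes "prime p" "CARD('a::{field,finite}) = p ^ e"
  shows "CHAR('a) = p"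
proof -
  have "(\<Sum>x\<in>UNIV. x + 1) = (\<Sum>x\<in>UNIV. x :: 'a)"
    by (rule sum.reindex_bij_witness[of _ "\<lambda>x. x - 1" "\<lambda>x. x + 1"]) auto
  then have "of_nat CARD('a) = (0 :: 'a)"
    by (simp add: sum.distrib)
  then have "of_nat p = (0 :: 'a)"
    by (simp add: assms(2))
  then have "CHAR('a) dvd p"
    by (simp add: of_nat_eq_0_iff_char_dvd)
  moreover have "CHAR('a) \<noteq> 1"
    using of_nat_CHAR[where ?'a = 'a] by (metis of_nat_1 zero_neq_one)
  ultimately show ?thesis
    using assms(1) prime_nat_iff by blast
qed

text \<open>Root counting stands in for a generator of the multiplicative group: the degree of
  \<open>x ^ m - b\<close> bounds the number of its roots from above, the degree of a cofactor
  bounds it from below.\<close>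

lemma finite_field_card_power_eq:
  fixes b :: "'a::{field,finite}"
  assumes m: "m dvd CARD('a) - 1" and b: "b ^ ((CARD('a) - 1) div m) = 1"
  shows "card {x. x ^ m = b} = m"
proof (rule antisym)
  have "CARD('a) > 1"
    using card_mono[of "UNIV :: 'a set" "{0, 1}"] by simp
  then have pos: "m > 0" "CARD('a) - 1 > 0"
    using m by (auto intro: Nat.gr0I)
  obtain s where s: "CARD('a) - 1 = m * s"
    using m by auto
  with b pos have s_pos: "s > 0" and bs: "b ^ s = 1"
    by (auto intro: Nat.gr0I)
  have "coeff (monom 1 m - [:b:]) m \<noteq> 0"
    using pos(1) by (cases m) auto
  then have "monom 1 m - [:b:] \<noteq> 0"
    by (metis coeff_0)
  then have "card {x. poly (monom 1 m - [:b:]) x = 0} \<le> degree (monom 1 m - [:b:])"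
    by (rule card_poly_roots_bound)
  also have "\<dots> \<le> m"
    by (intro degree_diff_le) (auto simp: degree_monom_le)
  finally show "card {x. x ^ m = b} \<le> m"
    by (simp add: poly_monom)

  \<comment> \<open>\<open>(x ^ m - b) * h(x) = x ^ (m * s) - b ^ s\<close> vanishes at every nonzero \<open>x\<close>, while \<open>h\<close> has at most
    \<open>m * (s - 1)\<close> roots.\<close>
  define h where "h = (\<Sum>i<s. monom (b ^ (s - Suc i)) (m * i))"
  have "coeff h (m * (s - 1)) = (\<Sum>i<s. if i = s - 1 then b ^ (s - Suc i) else 0)"
    using pos(1) by (auto simp: h_def coeff_sum intro!: sum.cong)
  also have "\<dots> = 1"
    using s_pos by simp
  finally have "h \<noteq> 0" by auto
  have "degree h \<le> m * (s - 1)"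
    unfolding h_def
    by (intro degree_sum_le order.trans[OF degree_monom_le]) auto
  with card_poly_roots_bound[OF \<open>h \<noteq> 0\<close>] have h: "card {x. poly h x = 0} \<le> m * (s - 1)"
    by linarith
  have "x ^ m = b \<or> poly h x = 0" if "x \<noteq> 0" for x
  proof -
    have "(x ^ m - b) * poly h x = (x ^ m) ^ s - b ^ s"
      by (simp add: h_def poly_sum poly_monom power_diff_sumr2 power_mult)
    also have "\<dots> = 0"
      using finite_field_power_card[OF that] by (simp add: s bs power_mult del: One_nat_def)
    finally show ?thesis by simp
  qed
  then have "CARD('a) - 1 \<le> card ({x. x ^ m = b} \<union> {x. poly h x = 0})"
    using card_mono[of "{x. x ^ m = b} \<union> {x. poly h x = 0}" "UNIV - {0}"] by auto
  also have "\<dots> \<le> card {x. x ^ m = b} + m * (s - 1)"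
    using card_Un_le h by (meson add_left_mono order.trans)
  finally show "m \<le> card {x. x ^ m = b}"
    using s s_pos by (cases s) auto
qed

text \<open>The sum is the coefficient of degree \<open>card A - 1\<close> in the Lagrange
  interpolation of \<open>R\<close> on \<open>A\<close>, which is \<open>R\<close> itself and has
  smaller degree.\<close>

lemma sum_poly_over_prod_diff:
  fixes A :: "'a::field set"
  assumes A: "finite A" and R: "degree R + 1 < card A"
  shows "(\<Sum>x\<in>A. poly R x / (\<Prod>y\<in>A-{x}. x - y)) = 0"
proof -
  define d where "d x = (\<Prod>y\<in>A-{x}. x - y)" for x
  define g where "g x = (\<Prod>y\<in>A-{x}. [:-y, 1:])" for x
  define L where "L = (\<Sum>x\<in>A. Polynomial.smult (poly R x / d x) (g x))"
  have g_monic: "degree (\<Prod>y\<in>S. [:-y, 1:] :: 'a poly) = card S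
      \<and> coeff (\<Prod>y\<in>S. [:-y, 1:] :: 'a poly) (card S) = 1" if "finite S" for S :: "'a set"
    using degree_prod_sum_eq[of S "\<lambda>y. [:-y, 1:]"] lead_coeff_prod[of "\<lambda>y. [:-y, 1:]" S] by simp
  have g: "degree (g x) = card A - 1" "coeff (g x) (card A - 1) = 1" if "x \<in> A" for x
    using g_monic[of "A - {x}"] that A by (simp_all add: g_def)
  have "L = R"
  proof (rule poly_eqI_degree[where A = A])
    fix z assume z: "z \<in> A"
    have "poly L z = (\<Sum>x\<in>A. if x = z then poly R z else 0)"
      unfolding L_def poly_sum
    proof (rule sum.cong[OF refl])
      fix x assume "x \<in> A"
      have "d z \<noteq> 0"
        using A by (simp add: d_def)
      then show "poly (Polynomial.smult (poly R x / d x) (g x)) z = (if x = z then poly R z else 0)"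
        using z A by (auto simp: g_def d_def poly_prod)
    qed
    then show "poly L z = poly R z"
      using A z by simp
  next
    have "degree L \<le> card A - 1"
      unfolding L_def using A g by (intro degree_sum_le order.trans[OF degree_smult_le]) auto
    then show "degree L < card A"
      using R by linarith
  qed (use R in simp)
  then have "0 = coeff L (card A - 1)"
    using R by (simp add: coeff_eq_0)
  also have "\<dots> = (\<Sum>x\<in>A. poly R x / d x)"
    using g by (simp add: L_def coeff_sum)
  finally show ?thesis
    by (simp add: d_def)
qed

text \<open>The map \<open>y \<mapsto> y ^ K\<close> permutes \<open>A\<close>, so it carries the product at \<open>x\<close> to the product at
  \<open>\<zeta> * x\<close>; multiplication by \<open>\<zeta>\<close> permutes \<open>A\<close> as well and changes the product only by the
  factor \<open>\<zeta> ^ (card A - 1) = 1\<close>.\<close>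

lemma prod_diff_power_fixed:
  fixes A :: "'a::field set"
  assumes A: "finite A" and K: "K > 0"
    and frob: "\<And>x y :: 'a. (x - y) ^ K = x ^ K - y ^ K"
    and closed: "\<And>x \<zeta>. x \<in> A \<Longrightarrow> \<zeta> ^ m = 1 \<Longrightarrow> \<zeta> * x \<in> A"
    and twist: "\<And>x. x \<in> A \<Longrightarrow> \<exists>\<zeta>. \<zeta> ^ m = 1 \<and> x ^ K = \<zeta> * x"
    and m: "m > 0" "m dvd card A - 1" and x: "x \<in> A"
  shows "(\<Prod>y\<in>A-{x}. x - y) ^ K = (\<Prod>y\<in>A-{x}. x - y)"
proof -
  obtain \<zeta> where \<zeta>: "\<zeta> ^ m = 1" "x ^ K = \<zeta> * x"
    using twist[OF x] by blast
  have \<zeta>0: "\<zeta> \<noteq> 0"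
    using \<zeta>(1) m(1) by (auto simp: power_0_left)
  have inj: "inj (\<lambda>y :: 'a. y ^ K)"
  proof (rule injI)
    fix x y :: 'a assume "x ^ K = y ^ K"
    then have "(x - y) ^ K = 0" by (simp add: frob)
    then show "x = y" by simp
  qed
  have "(\<lambda>y. y ^ K) ` A = A"
    using A twist closed
    by (intro card_subset_eq) (auto simp: card_image inj_on_subset[OF inj], metis)
  then have frob_image: "(\<lambda>y. y ^ K) ` (A - {x}) = A - {\<zeta> * x}"
    using x \<zeta>(2) by (simp add: image_set_diff[OF inj])
  have "(*) \<zeta> ` A = A"
    using A closed \<zeta> \<zeta>0 by (intro card_subset_eq) (auto simp: card_image inj_on_def)
  then have \<zeta>_image: "(*) \<zeta> ` (A - {x}) = A - {\<zeta> * x}"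
    using x \<zeta>0 image_set_diff[of "(*) \<zeta>" A "{x}"] by (simp add: inj_def)
  have "(\<Prod>y\<in>A-{x}. x - y) ^ K = (\<Prod>y\<in>A-{x}. \<zeta> * x - y ^ K)"
    by (simp add: prod_power_distrib frob \<zeta>(2))
  also have "\<dots> = (\<Prod>y\<in>A-{\<zeta> * x}. \<zeta> * x - y)"
    by (simp add: prod.reindex[OF inj_on_subset[OF inj]] flip: frob_image)
  also have "\<dots> = (\<Prod>y\<in>A-{x}. \<zeta> * (x - y))"
    unfolding \<zeta>_image[symmetric]
    by (subst prod.reindex) (use \<zeta>0 in \<open>auto simp: inj_on_def algebra_simps\<close>)
  also have "\<dots> = \<zeta> ^ (card A - 1) * (\<Prod>y\<in>A-{x}. x - y)"
    using A x by (simp add: prod.distrib)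
  also have "\<zeta> ^ (card A - 1) = 1"
    using m(2) \<zeta>(1) by (auto simp: power_mult)
  finally show ?thesis by simp
qed

lemma diff_1_dvd_power_diff_1: "(x :: nat) - 1 dvd x ^ n - 1"
proof (cases "x = 0")
  case False
  have "int x - 1 dvd int x ^ n - 1"
    by (metis dvd_triv_left power_diff_1_eq)
  with False show ?thesis
    by (simp add: of_nat_diff flip: of_nat_dvd_iff[where ?'a = int])
qed (cases n, auto)

text \<open>Surjectivity of the norm onto the nonzero elements fixed by \<open>x ^ K\<close>: such a
  \<open>w\<close> satisfies \<open>w ^ (K - 1) = 1\<close>, and \<open>K - 1\<close> divides
  \<open>(CARD('a) - 1) div (K + 1)\<close>, so \<open>w\<close> has \<open>K + 1\<close> roots of
  order \<open>K + 1\<close>.\<close>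

lemma finite_field_power_minus_1_surj:
  fixes w :: "'a::{field,finite}"
  assumes "(K - 1) * (K + 1) dvd CARD('a) - 1" "w ^ K = w" "w \<noteq> 0" "K > 0"
  obtains u where "u ^ (K + 1) = w" "u \<noteq> 0"
proof -
  obtain c where c: "CARD('a) - 1 = (K - 1) * (K + 1) * c"
    using assms(1) by auto
  have "w ^ (K - 1) * w = 1 * w"
    using assms(2,4) by (cases K) (simp_all add: mult.commute)
  then have "w ^ (K - 1) = 1"
    using assms(3) mult_right_cancel by blast
  then have "w ^ ((K - 1) * c) = 1"
    by (simp add: power_mult)
  moreover have "(CARD('a) - 1) div (K + 1) = (K - 1) * c"
    unfolding c using nonzero_mult_div_cancel_left[of "K + 1" "(K - 1) * c"]
    by (simp only: mult_ac)
  ultimately have "card {u. u ^ (K + 1) = w} = K + 1"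
    by (intro finite_field_card_power_eq) (auto simp: c simp del: One_nat_def)
  then have "{u. u ^ (K + 1) = w} \<noteq> {}"
    by (metis add_is_0 card.empty zero_neq_one)
  then obtain u where "u ^ (K + 1) = w" by blast
  then show thesis
    using assms(3) that[of u] by fastforce
qed

text \<open>Since \<open>m * t\<close> divides \<open>CARD('a) - 1\<close>, every \<open>b\<close>
  with \<open>b ^ t = 1\<close> has exactly \<open>m\<close> roots of order \<open>m\<close>, and
  fibres over distinct \<open>b\<close> are disjoint.\<close>

lemma ex_union_of_power_fibres:
  fixes m t r :: nat
  assumes mt: "m * t dvd CARD('a::{field,finite}) - 1" and r: "r \<le> t"
  obtains B :: "'a::{field,finite} set" where "\<And>b. b \<in> B \<Longrightarrow> b ^ t = 1" "card {x. x ^ m \<in> B} = r * m"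
proof -
  obtain c where c: "CARD('a) - 1 = m * t * c"
    using mt by auto
  have "CARD('a) > 1"
    using card_mono[of "UNIV :: 'a set" "{0, 1}"] by simp
  with c have pos: "m > 0" "t > 0"
    by (auto intro: Nat.gr0I)
  have "card {b :: 'a. b ^ t = 1} = t"
    by (rule finite_field_card_power_eq) (simp_all add: c del: One_nat_def)
  then obtain B :: "'a set" where B: "B \<subseteq> {b. b ^ t = 1}" "card B = r"
    using r obtain_subset_with_card_n[of r "{b :: 'a. b ^ t = 1}"] by auto
  have fibre: "card {x. x ^ m = b} = m" if "b \<in> B" for b
    using B(1) that pos by (intro finite_field_card_power_eq) (auto simp: c power_mult mult.assoc simp del: One_nat_def)
  have "{x. x ^ m \<in> B} = (\<Union>b\<in>B. {x. x ^ m = b})"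
    by auto
  then have "card {x. x ^ m \<in> B} = (\<Sum>b\<in>B. card {x. x ^ m = b})"
    by (simp only:) (rule card_UN_disjoint, auto)
  with fibre B(2) have "card {x. x ^ m \<in> B} = r * m"
    by simp
  with B(1) show thesis
    using that[of B] by auto
qed

section \<open>Evaluation codes and their Galois hulls\<close>

text \<open>Coordinates in a basis identify \<open>C\<close> with the functions from the basis to
  the field. The dimensions of codes and hulls below are thus found by counting words.\<close>

lemma code_dim_eqI_card:
  fixes C :: "'a::{field,finite} vec set"
  assumes sub: "VectorSpace.subspace class_ring C (module_vec TYPE('a) N)"
    and card: "card C = CARD('a) ^ h"
  shows "code_dim N C = h"
proof -
  let ?V = "(module_vec TYPE('a) N)\<lparr>carrier := C\<rparr>"
  interpret W: vectorspace "class_ring :: 'a ring" ?V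
    by (rule vectorspace.subspace_is_vs[OF vec_vs sub])
  have "finite C"
    by (rule card_ge_0_finite) (simp add: card)
  moreover have "W.span C = C"
    using W.in_own_span[of C] W.span_is_subset2[of C] by auto
  ultimately have "W.fin_dim"
    unfolding W.fin_dim_def by (intro exI[of _ C]) simp
  then obtain B where B: "finite B" "W.basis B"
    using W.finite_basis_exists by blast
  have sub: "B \<subseteq> C"
    using B(2) by (simp add: W.basis_def)
  have ex1: "\<exists>!a. a \<in> B \<rightarrow>\<^sub>E UNIV \<and> W.lincomb a B = v" if "v \<in> C" for v
    using W.basis_criterion[OF B(1)] B(2) sub that by simp
  have closed: "W.lincomb a B \<in> C" for a
    using W.lincomb_closed[of B a] sub by simp
  have "bij_betw (\<lambda>a. W.lincomb a B) (B \<rightarrow>\<^sub>E UNIV) C"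
    unfolding bij_betw_def
  proof
    show "inj_on (\<lambda>a. W.lincomb a B) (B \<rightarrow>\<^sub>E UNIV)"
      using ex1[OF closed] by (intro inj_onI) metis
    show "(\<lambda>a. W.lincomb a B) ` (B \<rightarrow>\<^sub>E UNIV) = C"
      using ex1 closed by auto (metis image_iff)
  qed
  then have "card C = CARD('a) ^ card B"
    using B(1) by (simp add: bij_betw_same_card[symmetric] card_PiE)
  moreover have "CARD('a) > 1"
    using card_mono[of "UNIV :: 'a set" "{0, 1}"] by simp
  ultimately have "card B = h"
    using card by simp
  then show ?thesis
    using W.dim_basis[OF B] by (simp add: code_dim_def)
qed

text \<open>A polynomial corresponds to its first \<open>k\<close> coefficients. For
  \<open>k = 0\<close> the count would fail: the zero polynomial has degree 0, so the set is
  empty.\<close>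

lemma card_degree_less:
  assumes "k > 0"
  shows "card {P :: 'a::{field,finite} poly. degree P < k} = CARD('a) ^ k"
proof -
  have "bij_betw (\<lambda>P. restrict (coeff P) {..<k}) {P :: 'a poly. degree P < k} ({..<k} \<rightarrow>\<^sub>E UNIV)"
    unfolding bij_betw_def
  proof
    show "inj_on (\<lambda>P. restrict (coeff P) {..<k}) {P :: 'a poly. degree P < k}"
    proof (rule inj_onI, rule poly_eqI)
      fix P Q :: "'a poly" and i
      assume *: "P \<in> {P. degree P < k}" "Q \<in> {P. degree P < k}"
        and eq: "restrict (coeff P) {..<k} = restrict (coeff Q) {..<k}"
      show "coeff P i = coeff Q i"
        using * fun_cong[OF eq, of i] by (cases "i < k") (auto simp: coeff_eq_0)
    qed
    show "(\<lambda>P. restrict (coeff P) {..<k}) ` {P :: 'a poly. degree P < k} = {..<k} \<rightarrow>\<^sub>E UNIV"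
    proof (intro equalityI subsetI)
      fix f :: "nat \<Rightarrow> 'a" assume f: "f \<in> {..<k} \<rightarrow>\<^sub>E UNIV"
      define P where "P = (\<Sum>i<k. monom (f i) i)"
      have c: "coeff P i = (if i < k then f i else 0)" for i
        by (simp add: P_def coeff_sum)
      have "degree P < k"
        using assms by (intro degree_lessI) (auto simp: c)
      moreover have "f = restrict (coeff P) {..<k}"
        using f by (auto simp: c fun_eq_iff PiE_def extensional_def)
      ultimately show "f \<in> (\<lambda>P. restrict (coeff P) {..<k}) ` {P. degree P < k}"
        by blast
    qed (auto split: if_splits)
  qed
  then show ?thesis
    by (simp add: bij_betw_same_card card_PiE)
qed

text \<open>The assumption \<open>zeros\<close> says that any \<open>k\<close> of the \<open>M\<close> functionals are linearly independent on
  the polynomials of degree less than \<open>k\<close>.\<close>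

locale mds_functionals =
  fixes k M :: nat and \<phi> :: "nat \<Rightarrow> 'a::{field,finite} poly \<Rightarrow> 'a"
  assumes k_pos: "k > 0" and k_le: "k \<le> M"
    and add: "\<phi> i (P + Q) = \<phi> i P + \<phi> i Q"
    and smult: "\<phi> i (Polynomial.smult c P) = c * \<phi> i P"
    and zeros: "P \<noteq> 0 \<Longrightarrow> degree P < k \<Longrightarrow> card {i. i < M \<and> \<phi> i P = 0} < k"
begin

definition msgs :: "'a poly set" where
  "msgs = {P. degree P < k}"

text \<open>\<open>N\<close> and \<open>v\<close> stay open so that one family of functionals serves
  all three code lengths.\<close>

definition word :: "nat \<Rightarrow> (nat \<Rightarrow> 'a) \<Rightarrow> 'a poly \<Rightarrow> 'a vec" where
  "word N v P = vec N (\<lambda>i. v i * \<phi> i P)"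

lemma zero: "\<phi> i 0 = 0"
  using smult[of i 0 0] by simp

lemma diff: "\<phi> i (P - Q) = \<phi> i P - \<phi> i Q"
  using add[of i "P - Q" Q] by simp

lemma card_msgs: "card msgs = CARD('a) ^ k"
  unfolding msgs_def by (rule card_degree_less[OF k_pos])

lemma msgs_closed:
  "0 \<in> msgs" "P \<in> msgs \<Longrightarrow> Q \<in> msgs \<Longrightarrow> P + Q \<in> msgs"
  "P \<in> msgs \<Longrightarrow> Q \<in> msgs \<Longrightarrow> P - Q \<in> msgs" "P \<in> msgs \<Longrightarrow> Polynomial.smult c P \<in> msgs"
  using k_pos by (auto simp: msgs_def degree_add_less degree_diff_less)

lemma eq_0_if_zeros:
  assumes "P \<in> msgs" "T \<subseteq> {..<M}" "card T \<ge> k" "\<And>i. i \<in> T \<Longrightarrow> \<phi> i P = 0"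
  shows "P = 0"
proof (rule ccontr)
  assume "P \<noteq> 0"
  then have "card {i. i < M \<and> \<phi> i P = 0} < k"
    using assms(1) zeros by (simp add: msgs_def)
  moreover have "card T \<le> card {i. i < M \<and> \<phi> i P = 0}"
    using assms by (intro card_mono) auto
  ultimately show False
    using assms(3) by simp
qed

text \<open>Injectivity comes from \<open>zeros\<close>; surjectivity follows because both sides
  have \<open>CARD('a) ^ k\<close> elements.\<close>

lemma eval_bij:
  assumes "T \<subseteq> {..<M}" "card T = k"
  shows "bij_betw (\<lambda>P. restrict (\<lambda>i. \<phi> i P) T) msgs (T \<rightarrow>\<^sub>E UNIV)"
proof -
  have fin: "finite T"
    using assms(1) finite_subset by blast
  have inj: "inj_on (\<lambda>P. restrict (\<lambda>i. \<phi> i P) T) msgs"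
  proof (rule inj_onI)
    fix P Q assume PQ: "P \<in> msgs" "Q \<in> msgs"
      and eq: "restrict (\<lambda>i. \<phi> i P) T = restrict (\<lambda>i. \<phi> i Q) T"
    have "\<phi> i (P - Q) = 0" if "i \<in> T" for i
      using that fun_cong[OF eq, of i] by (simp add: diff)
    then have "P - Q = 0"
      using assms PQ by (intro eq_0_if_zeros[of _ T]) (auto simp: msgs_closed)
    then show "P = Q" by simp
  qed
  have "(\<lambda>P. restrict (\<lambda>i. \<phi> i P) T) ` msgs = T \<rightarrow>\<^sub>E UNIV"
    by (rule card_subset_eq)
      (use fin in \<open>auto simp: finite_PiE card_image[OF inj] card_msgs card_PiE assms(2)\<close>)
  with inj show ?thesis
    by (simp add: bij_betw_def)
qed

lemma extend_indices:
  assumes "T \<subseteq> {..<M}" "card T \<le> k"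
  obtains T' where "T \<subseteq> T'" "T' \<subseteq> {..<M}" "card T' = k"
  using exists_subset_between[of T k "{..<M}"] assms k_le by auto

lemma interpolate:
  assumes "T \<subseteq> {..<M}" "card T \<le> k"
  obtains P where "P \<in> msgs" "\<And>i. i \<in> T \<Longrightarrow> \<phi> i P = f i"
proof -
  obtain T' where T': "T \<subseteq> T'" "T' \<subseteq> {..<M}" "card T' = k"
    using extend_indices assms by blast
  have "restrict f T' \<in> (\<lambda>P. restrict (\<lambda>i. \<phi> i P) T') ` msgs"
    using eval_bij[OF T'(2,3)] by (auto simp: bij_betw_def)
  then obtain P where P: "P \<in> msgs" "restrict f T' = restrict (\<lambda>i. \<phi> i P) T'"
    by auto
  have "\<phi> i P = f i" if "i \<in> T" for i
    using fun_cong[OF P(2), of i] that T'(1) by auto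
  with P(1) show thesis using that by blast
qed

text \<open>After extending \<open>T\<close> to \<open>k\<close> indices, the values at the added
  indices are free and determine the polynomial.\<close>

lemma card_ker:
  assumes "T \<subseteq> {..<M}" "card T \<le> k"
  shows "card {P \<in> msgs. \<forall>i\<in>T. \<phi> i P = 0} = CARD('a) ^ (k - card T)" (is "card ?K = _")
proof -
  obtain T' where T': "T \<subseteq> T'" "T' \<subseteq> {..<M}" "card T' = k"
    using extend_indices assms by blast
  have fin: "finite T'"
    using T'(2) finite_subset by blast
  let ?R = "\<lambda>P. restrict (\<lambda>i. \<phi> i P) (T' - T)"
  have "bij_betw ?R ?K (T' - T \<rightarrow>\<^sub>E UNIV)"
    unfolding bij_betw_def
  proof
    show "inj_on ?R ?K"
    proof (rule inj_onI)
      fix P Q assume PQ: "P \<in> ?K" "Q \<in> ?K" and eq: "?R P = ?R Q"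
      have "\<phi> i (P - Q) = 0" if "i \<in> T'" for i
        using that fun_cong[OF eq, of i] PQ by (cases "i \<in> T") (simp_all add: diff)
      then have "P - Q = 0"
        using T' PQ by (intro eq_0_if_zeros[of _ T']) (auto simp: msgs_closed)
      then show "P = Q" by simp
    qed
    show "?R ` ?K = T' - T \<rightarrow>\<^sub>E UNIV"
    proof (intro equalityI subsetI)
      fix f :: "nat \<Rightarrow> 'a" assume f: "f \<in> T' - T \<rightarrow>\<^sub>E UNIV"
      obtain P where P: "P \<in> msgs" "\<And>i. i \<in> T' \<Longrightarrow> \<phi> i P = (if i \<in> T then 0 else f i)"
        using T' interpolate[of T' "\<lambda>i. if i \<in> T then 0 else f i"] by auto
      have "f = ?R P"
        using f P(2) by (auto simp: fun_eq_iff PiE_def extensional_def)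
      moreover have "P \<in> ?K"
        using P T'(1) by auto
      ultimately show "f \<in> ?R ` ?K" by blast
    qed (auto split: if_splits)
  qed
  then have "card ?K = CARD('a) ^ card (T' - T)"
    using fin by (simp add: bij_betw_same_card card_PiE)
  then show ?thesis
    using T' fin by (simp add: card_Diff_subset finite_subset)
qed

section \<open>The code of length \<open>N\<close> with multipliers \<open>v\<close>\<close>

context
  fixes N :: nat and v :: "nat \<Rightarrow> 'a"
  assumes N: "k \<le> N" "N \<le> M" and v: "\<And>i. i < N \<Longrightarrow> v i \<noteq> 0"
begin

lemma inj_word: "inj_on (word N v) msgs"
proof (rule inj_onI)
  fix P Q assume PQ: "P \<in> msgs" "Q \<in> msgs" and eq: "word N v P = word N v Q"
  have "\<phi> i (P - Q) = 0" if "i < N" for i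
    using arg_cong[OF eq, of "\<lambda>x. x $ i"] that v[OF that] by (simp add: word_def diff)
  then have "P - Q = 0"
    using N PQ by (intro eq_0_if_zeros[of _ "{..<N}"]) (auto simp: msgs_closed)
  then show "P = Q" by simp
qed

text \<open>Stated for a general \<open>W\<close> because it is needed for the whole code and for
  its hull.\<close>

lemma subspace_word:
  assumes "W \<subseteq> msgs" "0 \<in> W" "\<And>P Q. P \<in> W \<Longrightarrow> Q \<in> W \<Longrightarrow> P + Q \<in> W"
    "\<And>c P. P \<in> W \<Longrightarrow> Polynomial.smult c P \<in> W"
  shows "VectorSpace.subspace class_ring (word N v ` W) (module_vec TYPE('a) N)"
proof -
  have "submodule class_ring (word N v ` W) (module_vec TYPE('a) N)"
  proof (rule submodule.intro)
    show "Module.module class_ring (module_vec TYPE('a) N)" by (rule vec_module)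
    show "word N v ` W \<subseteq> carrier (module_vec TYPE('a) N)"
      by (auto simp: module_vec_simps word_def)
    have "word N v 0 = 0\<^sub>v N"
      by (auto simp: word_def zero)
    then show "\<zero>\<^bsub>module_vec TYPE('a) N\<^esub> \<in> word N v ` W"
      using assms(2) by (auto simp: module_vec_simps image_iff intro!: bexI[of _ 0])
  next
    fix x y assume "x \<in> word N v ` W" "y \<in> word N v ` W"
    then obtain P Q where "x = word N v P" "P \<in> W" "y = word N v Q" "Q \<in> W" by auto
    moreover have "word N v P + word N v Q = word N v (P + Q)"
      by (auto simp: word_def add algebra_simps)
    ultimately show "x \<oplus>\<^bsub>module_vec TYPE('a) N\<^esub> y \<in> word N v ` W"
      using assms(3) by (auto simp: module_vec_simps)
  next
    fix c :: 'a and x assume "x \<in> word N v ` W"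
    then obtain P where "x = word N v P" "P \<in> W" by auto
    moreover have "c \<cdot>\<^sub>v word N v P = word N v (Polynomial.smult c P)"
      by (auto simp: word_def smult algebra_simps)
    ultimately show "c \<odot>\<^bsub>module_vec TYPE('a) N\<^esub> x \<in> word N v ` W"
      using assms(4) by (auto simp: module_vec_simps)
  qed
  then show ?thesis
    by (simp add: VectorSpace.subspace_def vec_vs)
qed

lemma hamming_dist_word:
  "hamming_dist (word N v P) (word N v Q) = N - card {i. i < N \<and> \<phi> i (P - Q) = 0}"
proof -
  have "{i. i < dim_vec (word N v P) \<and> word N v P $ i \<noteq> word N v Q $ i}
      = {..<N} - {i. i < N \<and> \<phi> i (P - Q) = 0}"
    using v by (auto simp: word_def diff)
  then have "hamming_dist (word N v P) (word N v Q)
      = card ({..<N} - {i. i < N \<and> \<phi> i (P - Q) = 0})"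
    by (simp add: hamming_dist_def)
  also have "\<dots> = N - card {i. i < N \<and> \<phi> i (P - Q) = 0}"
    by (subst card_Diff_subset) auto
  finally show ?thesis .
qed

lemma mds_word: "mds_code N k (word N v ` msgs)"
proof -
  let ?D = "{hamming_dist x y |x y. x \<in> word N v ` msgs \<and> y \<in> word N v ` msgs \<and> x \<noteq> y}"
  have sub: "VectorSpace.subspace class_ring (word N v ` msgs) (module_vec TYPE('a) N)"
    by (rule subspace_word) (auto simp: msgs_closed)
  then have "linear_code N k (word N v ` msgs)"
    by (simp add: linear_code_def code_dim_eqI_card card_image[OF inj_word] card_msgs)
  moreover have "min_dist (word N v ` msgs) = N - k + 1"
    unfolding min_dist_def
  proof (rule antisym)
    have lower: "N - k + 1 \<le> d" if "d \<in> ?D" for d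
    proof -
      obtain P Q where PQ: "P \<in> msgs" "Q \<in> msgs" "P \<noteq> Q"
        and d: "d = hamming_dist (word N v P) (word N v Q)"
        using \<open>d \<in> ?D\<close> by auto
      have "card {i. i < N \<and> \<phi> i (P - Q) = 0} \<le> card {i. i < M \<and> \<phi> i (P - Q) = 0}"
        using N by (intro card_mono) auto
      also have "\<dots> < k"
        using PQ msgs_closed(3)[OF PQ(1,2)] by (intro zeros) (auto simp: msgs_def)
      finally show ?thesis
        using N by (simp add: d hamming_dist_word)
    qed
    \<comment> \<open>Vanishing at \<open>k - 1\<close> indices leaves a line of polynomials; a
      nonzero one on it gives a word attaining the bound.\<close>
    have "card {P \<in> msgs. \<forall>i\<in>{..<k - 1}. \<phi> i P = 0} = CARD('a)"
      using k_pos k_le by (subst card_ker) auto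
    then have "{P \<in> msgs. \<forall>i\<in>{..<k - 1}. \<phi> i P = 0} \<noteq> {0}"
      using card_mono[of "UNIV :: 'a set" "{0, 1}"] by auto
    moreover have "0 \<in> {P \<in> msgs. \<forall>i\<in>{..<k - 1}. \<phi> i P = 0}"
      by (simp add: msgs_closed zero)
    ultimately obtain P where P: "P \<in> msgs" "P \<noteq> 0" "\<And>i. i < k - 1 \<Longrightarrow> \<phi> i P = 0"
      by auto
    have ne: "word N v P \<noteq> word N v 0"
      using P inj_on_eq_iff[OF inj_word, of P 0] by (simp add: msgs_closed)
    have mem: "hamming_dist (word N v P) (word N v 0) \<in> ?D"
      using P(1) ne msgs_closed(1) by blast
    have "card {..<k - 1} \<le> card {i. i < N \<and> \<phi> i (P - 0) = 0}"
      using P N by (intro card_mono) auto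
    then have "hamming_dist (word N v P) (word N v 0) \<le> N - k + 1"
      using k_pos N unfolding hamming_dist_word by simp
    then show "Inf ?D \<le> N - k + 1"
      using cInf_lower[OF mem] by simp
    show "N - k + 1 \<le> Inf ?D"
      using mem lower by (intro cInf_greatest) auto
  qed
  ultimately show ?thesis
    by (simp add: mds_code_def)
qed

text \<open>The index set \<open>T\<close> need not be contained in \<open>{..<N}\<close>: for a code punctured at a coordinate,
  the self-orthogonality of the longer code leaves that coordinate behind with a negative sign.\<close>

lemma code_dim_hull_word:
  assumes T: "T \<subseteq> {..<M}" "card T \<le> k" and c: "\<And>i. i \<in> T \<Longrightarrow> c i \<noteq> 0"
    and p: "p > 0"
    and gram: "\<And>P Q. P \<in> msgs \<Longrightarrow> Q \<in> msgs \<Longrightarrow>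
      (\<Sum>i<N. v i ^ (p ^ l + 1) * (\<phi> i P * \<phi> i Q ^ p ^ l)) = (\<Sum>i\<in>T. c i * (\<phi> i P * \<phi> i Q ^ p ^ l))"
  shows "code_dim N (galois_hull p l N (word N v ` msgs)) = k - card T"
proof -
  let ?K = "{P \<in> msgs. \<forall>i\<in>T. \<phi> i P = 0}"
  have fin: "finite T"
    using T(1) finite_subset by blast
  have form: "galois_form p l (word N v P) (word N v Q) = (\<Sum>i\<in>T. c i * (\<phi> i P * \<phi> i Q ^ p ^ l))"
    if "P \<in> msgs" "Q \<in> msgs" for P Q
    using gram[OF that] by (simp add: galois_form_def word_def power_mult_distrib mult_ac)
  have radical: "(\<forall>P\<in>msgs. galois_form p l (word N v P) (word N v Q) = 0) \<longleftrightarrow> (\<forall>i\<in>T. \<phi> i Q = 0)"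
    if Q: "Q \<in> msgs" for Q
  proof
    assume *: "\<forall>P\<in>msgs. galois_form p l (word N v P) (word N v Q) = 0"
    show "\<forall>i\<in>T. \<phi> i Q = 0"
    proof
      fix j assume j: "j \<in> T"
      \<comment> \<open>Testing against a polynomial that is 1 at \<open>j\<close> and 0 at the rest
        of \<open>T\<close> isolates the summand at \<open>j\<close>.\<close>
      obtain P where P: "P \<in> msgs" "\<And>i. i \<in> T \<Longrightarrow> \<phi> i P = of_bool (i = j)"
        using interpolate[OF T, of "\<lambda>i. of_bool (i = j)"] by blast
      have "0 = (\<Sum>i\<in>T. c i * (\<phi> i P * \<phi> i Q ^ p ^ l))"
        using * P(1) form[OF P(1) Q] by simp
      also have "\<dots> = (\<Sum>i\<in>T. if i = j then c i * \<phi> i Q ^ p ^ l else 0)"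
        using P(2) by (intro sum.cong) auto
      also have "\<dots> = c j * \<phi> j Q ^ p ^ l"
        using fin j by simp
      finally show "\<phi> j Q = 0"
        using c[OF j] p by simp
    qed
  qed (use Q p in \<open>auto simp: form power_0_left\<close>)
  \<comment> \<open>The dual pairs codewords in the first argument of the form, so the hull is the
    radical in the second one.\<close>
  have "galois_hull p l N (word N v ` msgs) = word N v ` ?K"
    using radical by (auto simp: galois_hull_def galois_dual_def word_def)
  moreover have "VectorSpace.subspace class_ring (word N v ` ?K) (module_vec TYPE('a) N)"
    by (rule subspace_word) (auto simp: msgs_closed zero add smult)
  moreover have "card (word N v ` ?K) = CARD('a) ^ (k - card T)"
    using card_ker[OF T] inj_on_subset[OF inj_word, of ?K] by (auto simp: card_image)
  ultimately show ?thesis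
    by (simp add: code_dim_eqI_card)
qed

end

end

section \<open>Codes from unions of power fibres\<close>

theorem theorem4:
  fixes p e q l m y m1 n r k :: nat
  assumes "prime p" and "odd p" and "e \<ge> 1" and "q = p ^ e"
    and "CARD('a::{field,finite}) = q"
    and "l \<le> e - 1" and "2 * l dvd e"
    and "m > 0" and "m dvd q - 1"
    and "y = (q - 1) div (p ^ l - 1)"
    and "m1 = m div gcd m y"
    and "n = r * m" and "1 \<le> r" and "r \<le> (p ^ l - 1) div m1"
    and "1 \<le> k" and "k \<le> (p ^ l + n) div (p ^ l + 1)"
  shows "(\<forall>h. h \<le> k - 1 \<longrightarrow>
            (\<exists>C :: 'a vec set. mds_code n k C \<and> code_dim n (galois_hull p l n C) = h))
       \<and> (\<forall>h. h \<le> k \<longrightarrow>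
            (\<exists>C :: 'a vec set. mds_code (n + 1) k C \<and>
               code_dim (n + 1) (galois_hull p l (n + 1) C) = h))
       \<and> (\<forall>h. h \<le> k - 1 \<longrightarrow>
            (\<exists>C :: 'a vec set. mds_code (n + 2) k C \<and>
               code_dim (n + 2) (galois_hull p l (n + 2) C) = h))"
proof -

  \<comment> \<open>Arithmetic of the parameters and choice of the point set\<close>
  define K where "K = p ^ l"
  define t where "t = (K - 1) div m1"
  have p: "p \<ge> 3"
    using \<open>prime p\<close> \<open>odd p\<close> prime_ge_2_nat[of p] by (cases "p = 2") auto
  \<comment> \<open>For \<open>l = 0\<close> the divisibility would force
    \<open>e = 0\<close>.\<close>
  have l: "l \<ge> 1"
    using \<open>2 * l dvd e\<close> \<open>e \<ge> 1\<close> by (cases l) auto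
  have "p ^ 1 \<le> p ^ l"
    using l p by (intro power_increasing) auto
  then have K: "K \<ge> 3"
    using p by (simp add: K_def)
  have "CHAR('a) = p"
    using CHAR_eqI_card assms(1,4,5) by blast
  then have frob_add: "(x + z) ^ K = x ^ K + z ^ K" for x z :: 'a
    using freshmans_dream'[where ?'a = 'a] \<open>prime p\<close> by (simp add: K_def)
  have frob: "(x - z) ^ K = x ^ K - z ^ K" for x z :: 'a
    using frob_add[of "x - z" z] by simp

  have "(p ^ (2 * l)) - 1 dvd q - 1"
    using \<open>2 * l dvd e\<close> diff_1_dvd_power_diff_1 unfolding assms(4) by (auto simp: power_mult)
  moreover have "p ^ (2 * l) = K * K"
    by (simp add: K_def power_add mult_2)
  moreover have "(K - 1) * (K + 1) = K * K - 1"
    using K by (cases K) simp_all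
  ultimately have KK: "(K - 1) * (K + 1) dvd CARD('a) - 1"
    using assms(5) by simp
  then have "K - 1 dvd q - 1"
    using assms(5) dvd_mult_left by metis
  then have q1: "q - 1 = y * (K - 1)"
    using assms(10) by (simp add: K_def)
  have m_eq: "m = m1 * gcd m y"
    using assms(11) by simp
  \<comment> \<open>Cancel \<open>gcd m y\<close> in \<open>m dvd y * (K - 1)\<close>. Coprimality
    then removes \<open>y div gcd m y\<close>, so the division defining \<open>t\<close> is
    exact.\<close>
  have "m1 dvd (y div gcd m y) * (K - 1)"
  proof -
    have "m1 * gcd m y dvd ((y div gcd m y) * (K - 1)) * gcd m y"
      using \<open>m dvd q - 1\<close> m_eq q1 by (metis dvd_div_mult_self gcd_dvd2 mult.assoc mult.commute)
    then show ?thesis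
      using \<open>m > 0\<close> by simp
  qed
  moreover have "coprime m1 (y div gcd m y)"
    using \<open>m > 0\<close> unfolding assms(11) by (intro div_gcd_coprime) auto
  ultimately have "m1 dvd K - 1"
    using coprime_dvd_mult_right_iff by blast
  then have t: "K - 1 = m1 * t"
    by (simp add: t_def)
  have "m * t = gcd m y * (K - 1)"
    using m_eq t by (metis mult.assoc mult.commute)
  then have mt: "m * t dvd CARD('a) - 1"
    using q1 assms(5) by (simp add: mult_dvd_mono)
  have "r \<le> t"
    using assms(14) by (simp add: t_def K_def)
  then obtain B :: "'a set" where B: "\<And>b. b \<in> B \<Longrightarrow> b ^ t = 1" "card {x. x ^ m \<in> B} = r * m"
    using ex_union_of_power_fibres[OF mt] by blast
  define A where "A = {x. x ^ m \<in> B}"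
  have card_A: "card A = n"
    using B(2) assms(12) by (simp add: A_def)
  have t_pos: "t > 0"
    using t K by (auto intro: Nat.gr0I)
  have A0: "0 \<notin> A"
    using B(1)[of 0] t_pos \<open>m > 0\<close> by (auto simp: A_def power_0_left)

  \<comment> \<open>Lagrange denominators fixed by the Frobenius power\<close>
  define d where "d x = (\<Prod>z\<in>insert 0 A-{x}. x - z)" for x
  have d_nz: "d x \<noteq> 0" for x
    by (simp add: d_def)
  have d_frob: "d x ^ K = d x" if "x \<in> insert 0 A" for x
    unfolding d_def
  proof (rule prod_diff_power_fixed[where m = m])
    show "\<zeta> * x \<in> insert 0 A" if "x \<in> insert 0 A" "\<zeta> ^ m = 1" for x \<zeta> :: 'a
      using that by (auto simp: A_def power_mult_distrib)
    show "\<exists>\<zeta>. \<zeta> ^ m = 1 \<and> x ^ K = \<zeta> * x" if "x \<in> insert 0 A" for x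
    proof (cases "x = 0")
      case False
      then have "(x ^ m) ^ t = 1"
        using that B(1) by (auto simp: A_def)
      \<comment> \<open>The twisting root of unity is \<open>x ^ (K - 1)\<close>, by
        \<open>K - 1 = m1 * t\<close>.\<close>
      moreover have "(x ^ (K - 1)) ^ m = ((x ^ m) ^ t) ^ m1"
        by (simp only: t mult_ac flip: power_mult)
      ultimately have "(x ^ (K - 1)) ^ m = 1"
        by simp
      moreover have "x ^ K = x ^ (K - 1) * x"
        using K by (cases K) simp_all
      ultimately show ?thesis by blast
    qed (use K in \<open>auto simp: power_0_left intro: exI[of _ 1]\<close>)
    \<comment> \<open>Adjoining 0 leaves \<open>n = r * m\<close> other points, a multiple of
      \<open>m\<close>.\<close>
    show "m dvd card (insert 0 A) - 1"
      using A0 card_A assms(12) by simp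
  qed (use that frob K \<open>m > 0\<close> in auto)

  \<comment> \<open>Evaluation points and functionals\<close>
  obtain a0 where a0: "bij_betw a0 {0..<n} A"
    using ex_bij_betw_nat_finite[of A] card_A by auto
  define a where "a i = (if i < n then a0 i else 0)" for i
  have a_inj: "inj_on a {..n}"
    using a0 A0 by (auto simp: a_def bij_betw_def inj_on_def)
  have "a ` {..<n} = A"
    using a0 by (auto simp: a_def bij_betw_def)
  then have a_image: "a ` {..n} = insert 0 A"
    by (auto simp: a_def image_iff less_le)
  \<comment> \<open>Coordinate \<open>n\<close> is the evaluation point 0, coordinate \<open>n + 1\<close> the point at infinity.\<close>
  define \<phi> where "\<phi> i P = (if i \<le> n then poly P (a i) else coeff P (k - 1))" for i and P :: "'a poly"

  \<comment> \<open>This restates the bound on \<open>k\<close>: \<open>P * Q ^ K\<close> has degree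
    at most \<open>(k - 1) * (K + 1)\<close>, which must be below \<open>n\<close> for Lagrange's
    identity on the \<open>n + 1\<close> points.\<close>
  have k_bound: "(k - 1) * (K + 1) + 1 \<le> n"
  proof -
    have "k * (K + 1) \<le> (K + n) div (K + 1) * (K + 1)"
      using assms(16) by (simp only: K_def mult_le_mono1)
    also have "\<dots> \<le> K + n"
      by (rule div_times_less_eq_dividend)
    finally show ?thesis
      using \<open>1 \<le> k\<close> by (cases k) auto
  qed
  have "k - 1 \<le> (k - 1) * (K + 1)"
    by simp
  with k_bound have kn: "k \<le> n"
    by linarith

  interpret mds_functionals k "n + 2" \<phi>
  proof
    fix P :: "'a poly"
    assume P: "P \<noteq> 0" "degree P < k"
    have "card {i. i \<le> n \<and> poly P (a i) = 0} = card (a ` {i. i \<le> n \<and> poly P (a i) = 0})"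
      by (rule card_image[symmetric], rule inj_on_subset[OF a_inj]) auto
    also have "\<dots> \<le> card {x. poly P x = 0}"
      by (rule card_mono) (use P(1) in auto)
    also have "\<dots> \<le> degree P"
      by (rule card_poly_roots_bound[OF P(1)])
    finally have fin: "card {i. i \<le> n \<and> poly P (a i) = 0} \<le> degree P" .
    show "card {i. i < n + 2 \<and> \<phi> i P = 0} < k"
    \<comment> \<open>A zero at infinity lowers the degree below \<open>k - 1\<close>, which pays
      for the additional zero.\<close>
    proof (cases "coeff P (k - 1) = 0")
      case True
      then have "degree P \<noteq> k - 1"
        using P(1) leading_coeff_0_iff by metis
      moreover have "{i. i < n + 2 \<and> \<phi> i P = 0} = insert (n + 1) {i. i \<le> n \<and> poly P (a i) = 0}"
        using True by (auto simp: \<phi>_def)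
      ultimately show ?thesis
        using fin P(2) by simp
    next
      case False
      then have "{i. i < n + 2 \<and> \<phi> i P = 0} = {i. i \<le> n \<and> poly P (a i) = 0}"
        by (auto simp: \<phi>_def)
      then show ?thesis
        using fin P(2) by simp
    qed
  qed (use assms(15) kn in \<open>auto simp: \<phi>_def\<close>)

  \<comment> \<open>Column multipliers and the resulting Galois form\<close>
  define w where "w i = 1 / d (a i)" for i
  have w_nz: "w i \<noteq> 0" for i
    by (simp add: w_def d_nz)
  have self_orth: "(\<Sum>i\<le>n. w i * (\<phi> i P * \<phi> i Q ^ K)) = 0" if PQ: "P \<in> msgs" "Q \<in> msgs" for P Q
  proof -
    have "degree (P * Q ^ K) \<le> degree P + degree Q * K"
      by (intro order.trans[OF degree_mult_le] add_left_mono degree_power_le)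
    also have "\<dots> \<le> (k - 1) + (k - 1) * K"
      using PQ by (intro add_mono mult_right_mono) (auto simp: msgs_def)
    finally have "degree (P * Q ^ K) + 1 < card (insert 0 A)"
      using k_bound A0 card_A by simp
    then have "(\<Sum>x\<in>insert 0 A. poly (P * Q ^ K) x / d x) = 0"
      unfolding d_def by (rule sum_poly_over_prod_diff[rotated]) simp
    then show ?thesis
      by (simp add: sum.reindex[OF a_inj] w_def \<phi>_def flip: a_image)
  qed
  have "\<exists>u. u ^ (K + 1) = w i \<and> u \<noteq> 0" if "i \<le> n" for i
  proof -
    have "w i ^ K = w i"
      using d_frob[of "a i"] a_image that by (auto simp: w_def power_divide)
    then show ?thesis
      using finite_field_power_minus_1_surj[OF KK _ w_nz] K by (metis gr0I not_numeral_le_zero)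
  qed
  then obtain u where u: "\<And>i. i \<le> n \<Longrightarrow> u i ^ (K + 1) = w i \<and> u i \<noteq> 0"
    by metis
  \<comment> \<open>At most \<open>K + 1\<close> elements are excluded, fewer than the at least
    \<open>(K - 1) * (K + 1)\<close> nonzero ones, since \<open>K \<ge> 3\<close>.\<close>
  obtain \<alpha> :: 'a where \<alpha>: "\<alpha> \<noteq> 0" "\<alpha> ^ (K + 1) \<noteq> 1"
  proof -
    have gt: "CARD('a) - 1 > 0"
      using card_mono[of "UNIV :: 'a set" "{0, 1}"] by simp
    have "card {x :: 'a. x ^ (K + 1) = 1} = K + 1"
      by (rule finite_field_card_power_eq[OF dvd_mult_right[OF KK]]) simp
    also have "\<dots> < (K - 1) * (K + 1)"
      using K mult_strict_right_mono[of 1 "K - 1" "K + 1"] by simp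
    also have "\<dots> \<le> CARD('a) - 1"
      using KK gt by (rule dvd_imp_le)
    also have "\<dots> = card (UNIV - {0 :: 'a})"
      by simp
    finally have "\<not> UNIV - {0 :: 'a} \<subseteq> {x. x ^ (K + 1) = 1}"
      using card_mono[of "{x :: 'a. x ^ (K + 1) = 1}" "UNIV - {0}"] by auto
    then show thesis
      using that by auto
  qed

  define v where "v s i = (if i \<le> n then (if i < s then \<alpha> else 1) * u i else 1)" for s i :: nat
  define \<beta> where "\<beta> = \<alpha> ^ (K + 1) - 1"
  have \<beta>: "\<beta> \<noteq> 0"
    using \<alpha> by (simp add: \<beta>_def)
  have v_nz: "v s i \<noteq> 0" for s i
    using \<alpha>(1) u by (simp add: v_def)
  have v_pow: "v s i ^ (K + 1) = (if i < s then \<beta> * w i else 0) + w i" if "i \<le> n" for s i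
    using u[OF that] that by (simp add: v_def \<beta>_def power_mult_distrib algebra_simps)
  have v_inf: "v s (Suc n) = 1" for s
    by (simp add: v_def)
  \<comment> \<open>Self-orthogonality cancels the summands \<open>w i\<close>; only the excess
    \<open>\<beta> * w i\<close> at the scaled points remains.\<close>
  have gram: "(\<Sum>i\<le>n. v s i ^ (K + 1) * (\<phi> i P * \<phi> i Q ^ K)) = (\<Sum>i<s. \<beta> * w i * (\<phi> i P * \<phi> i Q ^ K))"
    if "P \<in> msgs" "Q \<in> msgs" "s \<le> n" for P Q s
  proof -
    have "(\<Sum>i\<le>n. v s i ^ (K + 1) * (\<phi> i P * \<phi> i Q ^ K))
        = (\<Sum>i\<le>n. (if i < s then \<beta> * w i * (\<phi> i P * \<phi> i Q ^ K) else 0) + w i * (\<phi> i P * \<phi> i Q ^ K))"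
      by (intro sum.cong refl, subst v_pow) (auto simp: distrib_right)
    also have "\<dots> = (\<Sum>i\<in>{i\<in>{..n}. i < s}. \<beta> * w i * (\<phi> i P * \<phi> i Q ^ K))"
      unfolding sum.inter_filter[OF finite_atMost] using self_orth that by (simp add: sum.distrib)
    also have "{i\<in>{..n}. i < s} = {..<s}"
      using that(3) by auto
    finally show ?thesis .
  qed

  \<comment> \<open>The three code lengths\<close>
  have "\<exists>C :: 'a vec set. mds_code n k C \<and> code_dim n (galois_hull p l n C) = h" if h: "h \<le> k - 1" for h
  proof (intro exI conjI)
    \<comment> \<open>The deleted point 0 costs one dimension besides the \<open>s\<close> scaled
      points, so \<open>k - (s + 1) = h\<close>.\<close>
    define s where "s = k - 1 - h"
    have s: "s \<le> n" "s < n" "Suc s \<le> k" "k - Suc s = h"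
      using h kn \<open>1 \<le> k\<close> by (auto simp: s_def)
    let ?c = "\<lambda>i. if i < s then \<beta> * w i else - w i"
    show "mds_code n k (word n (v s) ` msgs)"
      using kn v_nz by (intro mds_word) auto
    have "code_dim n (galois_hull p l n (word n (v s) ` msgs)) = k - card (insert n {..<s})"
    proof (rule code_dim_hull_word[where c = ?c])
      fix P Q assume PQ: "P \<in> msgs" "Q \<in> msgs"
      \<comment> \<open>As \<open>s < n\<close>, the point 0 is unscaled; removing its term from
        \<open>gram\<close> yields the coefficient \<open>- w n\<close>.\<close>
      have "v s n ^ (K + 1) = w n"
        using v_pow[of n s] s by simp
      then have "(\<Sum>i<n. v s i ^ (K + 1) * (\<phi> i P * \<phi> i Q ^ K))
          = (\<Sum>i<s. \<beta> * w i * (\<phi> i P * \<phi> i Q ^ K)) - w n * (\<phi> n P * \<phi> n Q ^ K)"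
        using gram[OF PQ s(1)] by (simp only: eq_diff_eq sum.lessThan_Suc flip: lessThan_Suc_atMost)
      also have "\<dots> = (\<Sum>i\<in>insert n {..<s}. ?c i * (\<phi> i P * \<phi> i Q ^ K))"
        using s by (simp add: algebra_simps)
      finally show "(\<Sum>i<n. v s i ^ (p ^ l + 1) * (\<phi> i P * \<phi> i Q ^ p ^ l))
          = (\<Sum>i\<in>insert n {..<s}. ?c i * (\<phi> i P * \<phi> i Q ^ p ^ l))"
        by (simp only: K_def)
    qed (use s kn v_nz \<beta> w_nz p in auto)
    then show "code_dim n (galois_hull p l n (word n (v s) ` msgs)) = h"
      using s by simp
  qed
  moreover have "\<exists>C :: 'a vec set. mds_code (n + 1) k C \<and> code_dim (n + 1) (galois_hull p l (n + 1) C) = h"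
    if h: "h \<le> k" for h
  proof (intro exI conjI)
    \<comment> \<open>No extra coordinate enters here, so all \<open>k\<close> dimensions are
      available and \<open>h = k\<close> is reached with \<open>s = 0\<close>.\<close>
    define s where "s = k - h"
    have s: "s \<le> n" "s \<le> k" "k - s = h"
      using h kn by (auto simp: s_def)
    show "mds_code (n + 1) k (word (n + 1) (v s) ` msgs)"
      using kn v_nz by (intro mds_word) auto
    have "code_dim (n + 1) (galois_hull p l (n + 1) (word (n + 1) (v s) ` msgs)) = k - card {..<s}"
    proof (rule code_dim_hull_word[where c = "\<lambda>i. \<beta> * w i"])
      fix P Q assume PQ: "P \<in> msgs" "Q \<in> msgs"
      show "(\<Sum>i<n + 1. v s i ^ (p ^ l + 1) * (\<phi> i P * \<phi> i Q ^ p ^ l))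
          = (\<Sum>i<s. \<beta> * w i * (\<phi> i P * \<phi> i Q ^ p ^ l))"
        using gram[OF PQ s(1)] by (simp only: K_def Suc_eq_plus1[symmetric] lessThan_Suc_atMost)
    qed (use s kn v_nz \<beta> w_nz p in auto)
    then show "code_dim (n + 1) (galois_hull p l (n + 1) (word (n + 1) (v s) ` msgs)) = h"
      using s by simp
  qed
  moreover have "\<exists>C :: 'a vec set. mds_code (n + 2) k C \<and> code_dim (n + 2) (galois_hull p l (n + 2) C) = h"
    if h: "h \<le> k - 1" for h
  proof (intro exI conjI)
    \<comment> \<open>The point at infinity, with multiplier 1, lies outside the self-orthogonal
      part and costs the one extra dimension.\<close>
    define s where "s = k - 1 - h"
    have s: "s \<le> n" "s < n" "Suc s \<le> k" "k - Suc s = h"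
      using h kn \<open>1 \<le> k\<close> by (auto simp: s_def)
    let ?c = "\<lambda>i. if i < s then \<beta> * w i else 1"
    show "mds_code (n + 2) k (word (n + 2) (v s) ` msgs)"
      using kn v_nz by (intro mds_word) auto
    have "code_dim (n + 2) (galois_hull p l (n + 2) (word (n + 2) (v s) ` msgs)) = k - card (insert (Suc n) {..<s})"
    proof (rule code_dim_hull_word[where c = ?c])
      fix P Q assume PQ: "P \<in> msgs" "Q \<in> msgs"
      have "(\<Sum>i<n + 2. v s i ^ (K + 1) * (\<phi> i P * \<phi> i Q ^ K))
          = (\<Sum>i<s. \<beta> * w i * (\<phi> i P * \<phi> i Q ^ K)) + \<phi> (Suc n) P * \<phi> (Suc n) Q ^ K"
        using gram[OF PQ s(1)]
        by (simp only: add_2_eq_Suc' lessThan_Suc_atMost sum.atMost_Suc v_inf power_one mult_1)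
      also have "\<dots> = (\<Sum>i\<in>insert (Suc n) {..<s}. ?c i * (\<phi> i P * \<phi> i Q ^ K))"
        using s by simp
      finally show "(\<Sum>i<n + 2. v s i ^ (p ^ l + 1) * (\<phi> i P * \<phi> i Q ^ p ^ l))
          = (\<Sum>i\<in>insert (Suc n) {..<s}. ?c i * (\<phi> i P * \<phi> i Q ^ p ^ l))"
        by (simp only: K_def)
    qed (use s kn v_nz \<beta> w_nz p in auto)
    then show "code_dim (n + 2) (galois_hull p l (n + 2) (word (n + 2) (v s) ` msgs)) = h"
      using s by simp
  qed
  ultimately show ?thesis by blast
qed

end
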